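(* Let $G$ be a finite group of order $N$, and let $p$ be a prime. Let $r \geq 1$ be an integer and let $b_{0}<b_{1}<\cdots<b_{r}$ be nonnegative integers such that $p^{b_{r}}$ divides $N$. Let $P_{b_{0}}$ be a subgroup of $G$ of order $p^{b_{0}}$. Then the number of ordered tuples $(P_{b_{1}},P_{b_{2}},\ldots,P_{b_{r}})$ such that each $P_{b_{i}}$ ($1 \leq i \leq r$) is a subgroup of $G$ of order $p^{b_{i}}$ and $$P_{b_{0}}\subset P_{b_{1}}\subset \cdots \subset P_{b_{r}}$$ is congruent to $1$ modulo $p$.
   Context: The order of a finite group is its number of elements. The symbol $\subset$ denotes containment of subgroups as subsets of $G$. The subgroup $P_{b_0}$ is fixed; only the tuple $(P_{b_1},\ldots,P_{b_r})$ varies in the count. *)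

theory Defs
  imports "HOL-Algebra.Sylow" "HOL-Number_Theory.Cong"
begin

end

theory Submission
  imports Defs "HOL-Algebra.Group_Action"
begin

text \<open>
  Choosing a chain one subgroup at a time reduces the count to a single step: if \<open>P\<close> is a
  subgroup of order \<open>p ^ a\<close>, then the number of subgroups \<open>T\<close> of order \<open>p ^ b\<close> that contain \<open>P\<close> is
  1 modulo \<open>p\<close>, whenever \<open>a \<le> b\<close> and \<open>p ^ b\<close> divides the order of the group
  (\<open>card_subgroups_prime_power_above_cong_1\<close>). For then every partial chain has a number of
  extensions that is 1 modulo \<open>p\<close>, so passing from length \<open>r\<close> to length \<open>r + 1\<close> does not
  change the number of chains modulo \<open>p\<close>.

  The single step is a relative form of Wielandt's proof of Sylow's theorem. Write the group order
  as \<open>p ^ b * m\<close> and let \<open>\<Omega>\<close> be the set of all subsets \<open>X\<close> of the group with \<open>p ^ b\<close> elements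
  and \<open>P <#> X = X\<close>. The group acts on \<open>\<Omega>\<close> by right translations. The stabiliser of \<open>X\<close> permutes
  the elements of \<open>X\<close> freely, so its order divides \<open>p ^ b\<close>. If the order is \<open>p ^ b\<close>, then \<open>X\<close>
  is a left coset of its stabiliser, hence a right coset of a conjugate of it, and that
  conjugate contains \<open>P\<close>. So such \<open>X\<close> are exactly the right cosets of the subgroups \<open>T\<close> to be
  counted. A coset determines its subgroup, so there are \<open>n * m\<close> of them if there are \<open>n\<close>
  subgroups \<open>T\<close>. Every other orbit has length divisible by \<open>p * m\<close>. Hence
  \<open>card \<Omega> = n * m\<close> modulo \<open>p * m\<close>.

  On the other hand an element of \<open>\<Omega>\<close> is just a choice of \<open>p ^ c\<close> right cosets of \<open>P\<close> with
  \<open>c = b - a\<close>, out of \<open>m * p ^ c\<close>. Dividing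
  \<open>(m * p ^ c) choose (p ^ c) = m * ((m * p ^ c - 1) choose (p ^ c - 1))\<close> by \<open>m\<close> leaves a binomial
  coefficient that is 1 modulo \<open>p\<close> by Pascal's rule.
\<close>

section \<open>Binomial coefficients modulo a prime\<close>

text \<open>
  The absorption identity makes \<open>p ^ c\<close> divide \<open>k\<close> times the coefficient, and \<open>k\<close> is too small to
  take up all the factors \<open>p\<close>.
\<close>

lemma prime_dvd_binomial_multiple_prime_power:
  fixes p c m k :: nat
  assumes "prime p" "0 < k" "k < p ^ c"
  shows "p dvd (m * p ^ c) choose k"
proof (rule ccontr)
  assume "\<not> p dvd (m * p ^ c) choose k"
  then have "coprime p ((m * p ^ c) choose k)"
    by (rule prime_imp_coprime[OF assms(1)])
  then have cop: "coprime (p ^ c) ((m * p ^ c) choose k)"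
    by simp
  have "k * ((m * p ^ c) choose k) = m * p ^ c * ((m * p ^ c - 1) choose (k - 1))"
    using assms(2) by (rule times_binomial_minus1_eq)
  then have "k * ((m * p ^ c) choose k) = p ^ c * (m * ((m * p ^ c - 1) choose (k - 1)))"
    by (simp only: mult_ac)
  then have "p ^ c dvd k * ((m * p ^ c) choose k)"
    by (rule dvdI)
  then have "p ^ c dvd k"
    using cop by (simp only: coprime_dvd_mult_left_iff)
  then have "p ^ c \<le> k"
    using assms(2) by (rule dvd_imp_le)
  with assms(3) show False by simp
qed

text \<open>
  Two neighbours \<open>n choose k\<close> and \<open>n choose Suc k\<close> with \<open>n = m * p ^ c - 1\<close> add up to a
  coefficient in row \<open>m * p ^ c\<close>, which \<open>p\<close> divides as long as
  \<open>Suc k < p ^ c\<close>. So modulo \<open>p\<close> the row starts with 1 and alternates in sign up to that point.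
\<close>

lemma binomial_pred_multiple_prime_power_cong:
  fixes p c m k :: nat
  assumes "prime p" "0 < m" "k < p ^ c"
  shows "[int ((m * p ^ c - 1) choose k) = (- 1) ^ k] (mod int p)"
  using assms(3)
proof (induction k)
  case 0
  then show ?case by simp
next
  case (Suc k)
  have "0 < m * p ^ c"
    using assms prime_gt_0_nat by simp
  then have "(m * p ^ c) choose Suc k = ((m * p ^ c - 1) choose k) + ((m * p ^ c - 1) choose Suc k)"
    by (metis Suc_pred' binomial_Suc_Suc)
  moreover have "p dvd (m * p ^ c) choose Suc k"
    using prime_dvd_binomial_multiple_prime_power[OF assms(1) _ Suc.prems] by simp
  ultimately have "int p dvd int ((m * p ^ c - 1) choose k) + int ((m * p ^ c - 1) choose Suc k)"
    by (metis int_dvd_int_iff of_nat_add)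
  moreover have "int p dvd int ((m * p ^ c - 1) choose k) - (- 1) ^ k"
    using Suc by (simp add: cong_iff_dvd_diff)
  ultimately have "int p dvd (int ((m * p ^ c - 1) choose k) + int ((m * p ^ c - 1) choose Suc k))
      - (int ((m * p ^ c - 1) choose k) - (- 1) ^ k)"
    by (rule dvd_diff)
  moreover have "(x + y) - (x - z) = y - (- 1) * z" for x y z :: int
    by simp
  ultimately show ?case unfolding cong_iff_dvd_diff power_Suc by simp
qed

lemma binomial_pred_prime_power_cong_1:
  fixes p c m :: nat
  assumes "prime p" "0 < m"
  shows "[(m * p ^ c - 1) choose (p ^ c - 1) = 1] (mod p)"
proof -
  have pos: "0 < p ^ c"
    using assms prime_gt_0_nat by simp
  \<comment> \<open>For \<open>p = 2\<close> the exponent may be odd, but then \<open>-1\<close> and \<open>1\<close> agree modulo \<open>p\<close>.\<close>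
  have "[(- 1) ^ (p ^ c - 1) = (1 :: int)] (mod int p)"
  proof (cases "p = 2")
    case True
    then show ?thesis
      by (cases "even (p ^ c - 1)") (auto simp: cong_iff_dvd_diff)
  next
    case False
    then have "odd p"
      using assms(1) prime_odd_nat[of p] prime_ge_2_nat[of p] by linarith
    then have "even (p ^ c - 1)" by simp
    then show ?thesis by simp
  qed
  moreover have "[int ((m * p ^ c - 1) choose (p ^ c - 1)) = (- 1) ^ (p ^ c - 1)] (mod int p)"
    using binomial_pred_multiple_prime_power_cong[OF assms] pos by simp
  ultimately have "[int ((m * p ^ c - 1) choose (p ^ c - 1)) = int 1] (mod int p)"
    by (metis cong_trans of_nat_1)
  then show ?thesis by (simp only: cong_int_iff)
qed

section \<open>Translations of subsets and right cosets\<close>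

lemma (in group_action) dvd_card_of_dvd_orbits:
  assumes "finite E" "\<And>x. x \<in> E \<Longrightarrow> k dvd card (orbit G \<phi> x)"
  shows "k dvd card E"
proof -
  have "card E = (\<Sum>orb\<in>orbits G E \<phi>. card orb)"
    using disjoint_sum[OF assms(1), of "\<lambda>_. 1 :: nat"] by simp
  moreover have "k dvd (\<Sum>orb\<in>orbits G E \<phi>. card orb)"
    by (rule dvd_sum) (use assms(2) in \<open>auto simp: orbits_def\<close>)
  ultimately show ?thesis by simp
qed

context group
begin

text \<open>
  Translating by \<open>g\<close> on the right reverses products; \<open>inv g\<close> turns this into a left action.
\<close>

lemma right_translation_action:
  assumes sub: "\<And>X. X \<in> E \<Longrightarrow> X \<subseteq> carrier G"
    and closed: "\<And>X g. \<lbrakk>X \<in> E; g \<in> carrier G\<rbrakk> \<Longrightarrow> X #> g \<in> E"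
  shows "group_action G E (\<lambda>g. \<lambda>X\<in>E. X #> inv g)"
proof -
  let ?\<phi> = "\<lambda>g. \<lambda>X\<in>E. X #> inv g"
  have bij: "?\<phi> g \<in> Bij E" if g: "g \<in> carrier G" for g
  proof -
    have "bij_betw (\<lambda>X. X #> inv g) E E"
      by (rule bij_betw_byWitness[where f' = "\<lambda>X. X #> g"])
        (use g closed in \<open>auto simp: coset_mult_assoc sub\<close>)
    then show ?thesis by (simp add: Bij_def)
  qed
  have "?\<phi> \<in> hom G (BijGroup E)"
  proof (rule homI)
    fix g h assume gh: "g \<in> carrier G" "h \<in> carrier G"
    have "?\<phi> (g \<otimes> h) = compose E (?\<phi> g) (?\<phi> h)"
      by (rule ext) (use gh closed in \<open>auto simp: compose_def restrict_def inv_mult_group coset_mult_assoc sub\<close>)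
    then show "?\<phi> (g \<otimes> h) = ?\<phi> g \<otimes>\<^bsub>BijGroup E\<^esub> ?\<phi> h"
      using gh bij by (simp add: BijGroup_def restrict_def)
  qed (use bij in \<open>simp add: BijGroup_def\<close>)
  then show ?thesis
    unfolding group_action_def group_hom_def group_hom_axioms_def
    by (simp add: group_BijGroup)
qed

lemma card_l_coset:
  assumes "H \<subseteq> carrier G" "x \<in> carrier G"
  shows "card (x <# H) = card H"
proof -
  have "x <# H = (\<lambda>h. x \<otimes> h) ` H" by (auto simp: l_coset_def)
  moreover have "inj_on (\<lambda>h. x \<otimes> h) H"
    by (rule inj_onI) (use assms Units_l_cancel Units_eq in blast)
  ultimately show ?thesis by (simp add: card_image)
qed

lemma card_r_coset:
  assumes "H \<subseteq> carrier G" "x \<in> carrier G"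
  shows "card (H #> x) = card H"
proof -
  have "H #> x = (\<lambda>h. h \<otimes> x) ` H" by (auto simp: r_coset_def)
  then show ?thesis using inj_on_g[OF assms] by (simp add: card_image)
qed

text \<open>
  If right translation by the elements of \<open>H\<close> fixes \<open>X\<close>, then \<open>X\<close> is a disjoint union of left
  cosets of \<open>H\<close>.
\<close>

lemma card_rtranslation_fixer_dvd:
  assumes H: "subgroup H G" and X: "X \<subseteq> carrier G" "finite X"
    and fixed: "\<And>h. h \<in> H \<Longrightarrow> X #> h = X"
  shows "card H dvd card X"
proof -
  interpret subgroup H G by (rule H)
  let ?C = "(\<lambda>x. x <# H) ` X"
  have sub: "x <# H \<subseteq> X" if "x \<in> X" for x
    using fixed that by (force simp: l_coset_def r_coset_def)
  have "x \<in> x <# H" if "x \<in> X" for x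
    using that X one_closed by (force simp: l_coset_def)
  then have U: "\<Union>?C = X" using sub by blast
  have "card H * card ?C = card (\<Union>?C)"
  proof (rule card_partition)
    show "card c = card H" if "c \<in> ?C" for c
      using that X subset by (auto intro: card_l_coset)
    show "c1 \<inter> c2 = {}" if "c1 \<in> ?C" "c2 \<in> ?C" "c1 \<noteq> c2" for c1 c2
      using that X l_repr_independence[OF _ _ H] by (smt (verit) disjoint_iff imageE subsetD)
  qed (use X U in auto)
  then show ?thesis unfolding U by (metis dvd_triv_left)
qed

text \<open>
  A subset that is invariant under left multiplication by \<open>P\<close> is a union of right cosets of \<open>P\<close>,
  and the cosets in it are determined by their union. So \<open>Union\<close> is a bijection from the sets of
  \<open>q\<close> cosets to the subsets counted here.
\<close>

lemma card_left_invariant_subsets: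
  assumes P: "subgroup P G" and fin: "finite (carrier G)"
  shows "card {X. X \<subseteq> carrier G \<and> card X = card P * q \<and> P <#> X = X}
           = card (rcosets P) choose q"
proof -
  interpret P: subgroup P G by (rule P)
  let ?A = "{S. S \<subseteq> rcosets P \<and> card S = q}"
  let ?B = "{X. X \<subseteq> carrier G \<and> card X = card P * q \<and> P <#> X = X}"
  have finR: "finite (rcosets P)"
    using fin by (simp add: RCOSETS_def)
  have carr: "\<Union>S \<subseteq> carrier G" if "S \<subseteq> rcosets P" for S
    using that rcosets_part_G[OF P] by blast
  have disj: "R1 \<inter> R2 = {}" if "R1 \<in> rcosets P" "R2 \<in> rcosets P" "R1 \<noteq> R2" for R1 R2
    using rcos_disjoint[OF P] that by (auto simp: pairwise_def disjnt_def)
  have cardU: "card (\<Union>S) = card P * card S" if S: "S \<subseteq> rcosets P" for S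
  proof (rule card_partition[symmetric])
    show "finite S" using S finR finite_subset by blast
    show "finite (\<Union>S)" using carr[OF S] fin finite_subset by blast
    show "card c = card P" if "c \<in> S" for c
      using that S P.subset by (auto simp: RCOSETS_def card_r_coset)
  qed (use S disj in blast)
  have coset_inv: "P <#> R = R" if "R \<in> rcosets P" for R
    using that P.subset by (auto simp: RCOSETS_def setmult_rcos_assoc subgroup_mult_id[OF P])
  have inj: "inj_on Union ?A"
  proof (rule inj_onI)
    fix S S' assume S: "S \<in> ?A" "S' \<in> ?A" "\<Union>S = \<Union>S'"
    have *: "S = {R \<in> rcosets P. R \<subseteq> \<Union>S}" if SP: "S \<subseteq> rcosets P" for S
    proof -
      have "R \<in> S" if R: "R \<in> rcosets P" "R \<subseteq> \<Union>S" for R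
      proof -
        obtain x where "x \<in> R" using P.rcosets_non_empty[OF R(1)] by blast
        moreover from this obtain R' where "R' \<in> S" "x \<in> R'" using R(2) by blast
        ultimately show ?thesis using disj[of R R'] R(1) SP by blast
      qed
      then show ?thesis using SP by blast
    qed
    show "S = S'" using *[of S] *[of S'] S by auto
  qed
  have "Union ` ?A = ?B"
  proof (intro equalityI subsetI)
    fix X assume "X \<in> Union ` ?A"
    then obtain S where S: "S \<subseteq> rcosets P" "card S = q" "X = \<Union>S" by blast
    have "P <#> \<Union>S = (\<Union>R\<in>S. P <#> R)" by (auto simp: set_mult_def)
    also have "\<dots> = \<Union>S" using coset_inv S(1) by auto
    finally show "X \<in> ?B" using S carr cardU by auto
  next
    fix X assume X: "X \<in> ?B"
    let ?S = "(\<lambda>x. P #> x) ` X"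
    have S: "?S \<subseteq> rcosets P" using X P.subset by (auto intro: rcosetsI)
    have "\<Union>?S = P <#> X" by (auto simp: r_coset_def set_mult_def)
    then have U: "\<Union>?S = X" using X by auto
    have "P \<noteq> {}" using P.one_closed by blast
    then have "card P > 0"
      using finite_subset[OF P.subset fin] by (simp add: card_gt_0_iff)
    then have "card ?S = q" using cardU[OF S] U X by auto
    then show "X \<in> Union ` ?A" using S U by blast
  qed
  then have "card ?B = card ?A" using card_image[OF inj] by simp
  then show ?thesis using n_subsets[OF finR] by simp
qed

text \<open>
  The subgroup can be read off its right coset \<open>X\<close>: it consists of the quotients
  \<open>x \<otimes> inv y\<close> with \<open>x\<close> and \<open>y\<close> in \<open>X\<close>.
\<close>

lemma subgroup_eq_of_common_rcoset:
  assumes "subgroup T G" "subgroup T' G" "X \<in> rcosets T" "X \<in> rcosets T'"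
  shows "T = T'"
proof -
  have "T' \<subseteq> T" if T: "subgroup T G" "subgroup T' G" and X: "X \<in> rcosets T" "X \<in> rcosets T'" for T T'
  proof
    fix t assume t: "t \<in> T'"
    interpret T': subgroup T' G by (rule T)
    obtain y where y: "y \<in> carrier G" "X = T' #> y" using X by (auto simp: RCOSETS_def)
    have "t \<otimes> y \<in> X" "y \<in> X"
      using t y T(2) T'.subset by (auto intro: rcosI rcos_self)
    then have "(t \<otimes> y) \<otimes> inv y \<in> T"
      by (rule diff_neutralizes[OF T(1) X(1)])
    then show "t \<in> T" using t y by (simp add: m_assoc)
  qed
  then show ?thesis using assms by blast
qed

section \<open>Subgroups of prime power order above a given one\<close>

text \<open>
  In the proof, \<open>\<A>\<close> collects the members of \<open>\<Omega>\<close> that are right cosets of a subgroup counted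
  here, and the rest of \<open>\<Omega>\<close> is shown to have cardinality divisible by \<open>p * m\<close>. The factor \<open>m\<close>
  matters: it may itself be divisible by \<open>p\<close>, so it has to be cancelled before reducing.
\<close>

proposition card_subgroups_prime_power_above_cong_1:
  fixes p a b :: nat
  assumes fin: "finite (carrier G)" and p: "prime p"
    and P: "subgroup P G" "card P = p ^ a"
    and ab: "a \<le> b" and dvd: "p ^ b dvd order G"
  shows "[card {T. subgroup T G \<and> card T = p ^ b \<and> P \<subseteq> T} = 1] (mod p)"
proof -
  interpret P: subgroup P G by (rule P)
  obtain m where m: "order G = p ^ b * m" using dvd by blast
  define c where "c = b - a"
  have bc: "p ^ b = p ^ a * p ^ c" using ab by (simp add: c_def flip: power_add)
  have p0: "p > 0" using p prime_gt_0_nat by blast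
  have m0: "m > 0"
    using m fin order_gt_0_iff_finite by (metis gr0I mult_0_right)
  define \<T> where "\<T> = {T. subgroup T G \<and> card T = p ^ b \<and> P \<subseteq> T}"
  define \<Omega> where "\<Omega> = {X. X \<subseteq> carrier G \<and> card X = p ^ b \<and> P <#> X = X}"
  define \<A> where "\<A> = (\<Union>T\<in>\<T>. rcosets T)"
  have finPow: "finite (Pow (carrier G))" using fin by simp
  have fin\<Omega>: "finite \<Omega>" by (rule finite_subset[OF _ finPow]) (auto simp: \<Omega>_def)
  have fin\<T>: "finite \<T>"
    by (rule finite_subset[OF _ finPow]) (auto simp: \<T>_def dest: subgroup.subset)
  have index: "card (rcosets T) * card T = p ^ b * m" if "subgroup T G" for T
    using lagrange[OF that] m by simp

  have "card \<Omega> = (m * p ^ c) choose (p ^ c)"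
  proof -
    have "card (rcosets P) = m * p ^ c"
      using index[OF P(1)] P(2) bc p0 by simp
    then show ?thesis
      using card_left_invariant_subsets[OF P(1) fin, of "p ^ c"] by (simp add: \<Omega>_def P(2) bc)
  qed
  also have "\<dots> = m * ((m * p ^ c - 1) choose (p ^ c - 1))"
  proof -
    have "p ^ c * ((m * p ^ c) choose (p ^ c)) = p ^ c * (m * ((m * p ^ c - 1) choose (p ^ c - 1)))"
      using times_binomial_minus1_eq[of "p ^ c" "m * p ^ c"] p0 by (simp add: algebra_simps)
    then show ?thesis using p0 by simp
  qed
  finally have card\<Omega>: "card \<Omega> = m * ((m * p ^ c - 1) choose (p ^ c - 1))" .

  have \<A>\<Omega>: "\<A> \<subseteq> \<Omega>"
  proof
    fix X assume "X \<in> \<A>"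
    then obtain T x where T: "subgroup T G" "card T = p ^ b" "P \<subseteq> T" and x: "x \<in> carrier G" "X = T #> x"
      by (auto simp: \<A>_def \<T>_def RCOSETS_def)
    have TG: "T \<subseteq> carrier G" using T(1) by (rule subgroup.subset)
    have "P <#> T \<subseteq> T"
      using mono_set_mult[OF T(3) subset_refl] subgroup_mult_id[OF T(1)] by blast
    moreover have "T \<subseteq> P <#> T"
    proof
      fix t assume t: "t \<in> T"
      then have "\<one> \<otimes> t \<in> P <#> T" using P.one_closed unfolding set_mult_def by blast
      then show "t \<in> P <#> T" using t TG by auto
    qed
    ultimately have "P <#> T = T" by blast
    then have "P <#> X = X"
      using setmult_rcos_assoc[OF P.subset TG x(1)] x(2) by simp
    then show "X \<in> \<Omega>"
      using x T TG by (simp add: \<Omega>_def card_r_coset r_coset_subset_G)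
  qed
  have "card \<A> = (\<Sum>T\<in>\<T>. card (rcosets T))"
    unfolding \<A>_def
  proof (rule card_UN_disjoint[OF fin\<T>])
    show "\<forall>T\<in>\<T>. finite (rcosets T)" using fin by (simp add: RCOSETS_def)
    show "\<forall>T\<in>\<T>. \<forall>T'\<in>\<T>. T \<noteq> T' \<longrightarrow> rcosets T \<inter> rcosets T' = {}"
    proof (intro ballI impI)
      fix T T' assume "T \<in> \<T>" "T' \<in> \<T>" "T \<noteq> T'"
      then show "rcosets T \<inter> rcosets T' = {}"
        using subgroup_eq_of_common_rcoset[of T T'] unfolding \<T>_def by blast
    qed
  qed
  also have "\<dots> = (\<Sum>T\<in>\<T>. m)"
  proof (rule sum.cong)
    fix T assume "T \<in> \<T>"
    then have "card (rcosets T) * p ^ b = m * p ^ b"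
      using index[of T] unfolding \<T>_def by (simp add: mult.commute)
    then show "card (rcosets T) = m" using p0 by simp
  qed simp
  finally have card\<A>: "card \<A> = card \<T> * m" by simp

  let ?\<phi> = "\<lambda>g. \<lambda>X\<in>\<Omega> - \<A>. X #> inv g"
  have \<Omega>_closed: "X #> g \<in> \<Omega>" if "X \<in> \<Omega>" "g \<in> carrier G" for X g
    using that by (simp add: \<Omega>_def r_coset_subset_G card_r_coset setmult_rcos_assoc[OF P.subset])
  have \<A>_closed: "X #> g \<in> \<A>" if X: "X \<in> \<A>" and g: "g \<in> carrier G" for X g
  proof -
    obtain T x where T: "T \<in> \<T>" and x: "x \<in> carrier G" "X = T #> x"
      using X by (auto simp: \<A>_def RCOSETS_def)
    have "T \<subseteq> carrier G" using T subgroup.subset by (auto simp: \<T>_def)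
    then have "X #> g \<in> rcosets T" using x g by (simp add: coset_mult_assoc rcosetsI)
    then show ?thesis using T by (auto simp: \<A>_def)
  qed
  have bad_closed: "X #> g \<in> \<Omega> - \<A>" if X: "X \<in> \<Omega> - \<A>" and g: "g \<in> carrier G" for X g
  proof -
    have "X #> g #> inv g = X" using X g by (simp add: \<Omega>_def coset_mult_assoc)
    then show ?thesis using \<Omega>_closed \<A>_closed[of "X #> g" "inv g"] X g by auto
  qed
  interpret act: group_action G "\<Omega> - \<A>" ?\<phi>
    by (rule right_translation_action) (use bad_closed in \<open>auto simp: \<Omega>_def\<close>)

  have "p * m dvd card (\<Omega> - \<A>)"
  proof (rule act.dvd_card_of_dvd_orbits)
    fix X assume X: "X \<in> \<Omega> - \<A>"
    then have XG: "X \<subseteq> carrier G" and cX: "card X = p ^ b" and PX: "P <#> X = X"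
      by (auto simp: \<Omega>_def)
    define H where "H = stabilizer G ?\<phi> X"
    have H: "subgroup H G" unfolding H_def by (rule act.stabilizer_subgroup[OF X])
    interpret H: subgroup H G by (rule H)
    have fixed: "X #> h = X" if "h \<in> H" for h
    proof -
      have "inv h \<in> H" using that by simp
      then have "?\<phi> (inv h) X = X" unfolding H_def stabilizer_def by blast
      then show ?thesis using X H.mem_carrier[OF that] by simp
    qed
    have "card H dvd p ^ b"
      using card_rtranslation_fixer_dvd[OF H XG finite_subset[OF XG fin] fixed] cX by simp
    then obtain j where j: "j \<le> b" "card H = p ^ j"
      using divides_primepow_nat[OF p] by blast
    \<comment> \<open>A stabiliser of order \<open>p ^ b\<close> would make \<open>X\<close> one of its left cosets \<open>x <# H\<close>, which is
      the right coset \<open>T #> x\<close> of the conjugate \<open>T = x <# H #> inv x\<close>.\<close>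
    have "j \<noteq> b"
    proof
      assume "j = b"
      obtain x where x: "x \<in> X" using cX p0 by fastforce
      have xG: "x \<in> carrier G" using x XG by blast
      have "x <# H \<subseteq> X" using fixed x by (force simp: l_coset_def r_coset_def)
      moreover have "card (x <# H) = card X"
        using card_l_coset[OF H.subset xG] j \<open>j = b\<close> cX by simp
      ultimately have xH: "x <# H = X"
        by (rule card_subset_eq[OF finite_subset[OF XG fin]])
      define T where "T = x <# H #> inv x"
      have T: "subgroup T G" unfolding T_def by (rule subgroup_conjugation_is_surj2[OF xG H])
      have Tx: "T #> x = X" using xH xG XG by (simp add: T_def coset_mult_assoc)
      have TG: "T \<subseteq> carrier G" using T by (rule subgroup.subset)
      have "P \<subseteq> T"
      proof
        fix y assume y: "y \<in> P"
        then have "y \<otimes> x \<in> T #> x" using x PX Tx by (auto simp: set_mult_def)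
        then show "y \<in> T"
          using subgroup.rcos_module[OF T is_group xG, of "y \<otimes> x"] y xG by (simp add: m_assoc)
      qed
      moreover have "card T = p ^ b" using card_r_coset[OF TG xG] Tx cX by simp
      ultimately have "T \<in> \<T>" using T by (simp add: \<T>_def)
      then have "X \<in> \<A>" using Tx rcosetsI[OF TG xG] by (auto simp: \<A>_def)
      with X show False by blast
    qed
    with j have jb: "j < b" by simp
    have "card (orbit G ?\<phi> X) * p ^ j = p ^ b * m"
      using act.orbit_stabilizer_theorem[OF X] j m by (simp add: H_def)
    also have "\<dots> = (p ^ (b - j) * m) * p ^ j"
    proof -
      have "p ^ b = p ^ (b - j) * p ^ j" using jb by (simp flip: power_add)
      then show ?thesis by simp
    qed
    finally have "card (orbit G ?\<phi> X) = p ^ (b - j) * m" using p0 by simp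
    moreover have "p dvd p ^ (b - j)" using jb by simp
    ultimately show "p * m dvd card (orbit G ?\<phi> X)" by simp
  qed (use fin\<Omega> in simp)
  then obtain k where "card (\<Omega> - \<A>) = p * m * k" by blast
  moreover have "card \<Omega> = card \<A> + card (\<Omega> - \<A>)"
    using card_Diff_subset[OF finite_subset[OF \<A>\<Omega> fin\<Omega>] \<A>\<Omega>] card_mono[OF fin\<Omega> \<A>\<Omega>] by simp
  ultimately have "m * ((m * p ^ c - 1) choose (p ^ c - 1)) = m * (card \<T> + p * k)"
    using card\<Omega> card\<A> by (simp add: algebra_simps)
  then have "(m * p ^ c - 1) choose (p ^ c - 1) = card \<T> + p * k" using m0 by simp
  then have "[card \<T> + p * k = 1] (mod p)"
    using binomial_pred_prime_power_cong_1[OF p m0, of c] by simp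
  then show ?thesis unfolding \<T>_def[symmetric] by (simp add: cong_def)
qed

end

section \<open>Chains of subgroups\<close>

lemma card_Sigma_cong:
  fixes n :: nat
  assumes "finite A" "\<And>x. x \<in> A \<Longrightarrow> finite (B x)" "\<And>x. x \<in> A \<Longrightarrow> [card (B x) = 1] (mod n)"
  shows "[card (Sigma A B) = card A] (mod n)"
proof -
  have "[(\<Sum>x\<in>A. card (B x)) = (\<Sum>x\<in>A. 1)] (mod n)"
    using assms(3) by (rule cong_sum)
  then show ?thesis using assms by simp
qed

text \<open>
  The predecessor of the first member of a chain is \<open>P0\<close>; writing it as the entry at index 0 makes
  all inclusions uniform, so that the induction can start at the empty chain, \<open>r = 0\<close>.
\<close>

lemma (in group) card_prime_power_subgroup_chains_cong_1:
  fixes p r :: nat and b :: "nat \<Rightarrow> nat"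
  assumes fin: "finite (carrier G)" and p: "prime p"
    and P0: "subgroup P0 G" "card P0 = p ^ b 0"
    and mono: "mono_on {0..r} b" and dvd: "p ^ b r dvd order G"
  shows "[card {P \<in> (\<Pi>\<^sub>E i\<in>{1..r}. {H. subgroup H G \<and> card H = p ^ b i}).
            \<forall>i<r. (if i = 0 then P0 else P i) \<subseteq> P (Suc i)} = 1] (mod p)"
  using mono dvd
proof (induction r)
  case 0
  then show ?case by simp
next
  case (Suc r)
  let ?S = "\<lambda>i. {H. subgroup H G \<and> card H = p ^ b i}"
  let ?prev = "\<lambda>P i. if i = 0 then P0 else P i"
  define C where "C = (\<lambda>r. {P \<in> (\<Pi>\<^sub>E i\<in>{1..r}. ?S i). \<forall>i<r. ?prev P i \<subseteq> P (Suc i)})"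
  define ext where "ext = (\<lambda>P. {H. subgroup H G \<and> card H = p ^ b (Suc r) \<and> ?prev P r \<subseteq> H})"
  have le: "b r \<le> b (Suc r)" using Suc.prems(1) by (auto simp: mono_on_def)
  have finS: "finite (?S i)" for i
    by (rule finite_subset[where B = "Pow (carrier G)"]) (use fin in \<open>auto dest: subgroup.subset\<close>)
  have finC: "finite (C r)"
    unfolding C_def by (rule finite_subset[of _ "\<Pi>\<^sub>E i\<in>{1..r}. ?S i"]) (auto intro: finite_PiE finS)
  have prev: "?prev P r \<in> ?S r" if "P \<in> C r" for P
    using that P0 unfolding C_def by (cases "r = 0") (auto simp: PiE_iff)
  have card_ext: "[card (ext P) = 1] (mod p)" if "P \<in> C r" for P
    using card_subgroups_prime_power_above_cong_1[OF fin p _ _ le Suc.prems(2)] prev[OF that]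
    unfolding ext_def by blast
  have extend: "P(Suc r := H) \<in> C (Suc r)" if "P \<in> C r" and "H \<in> ext P" for P H
  proof -
    have P: "P \<in> (\<Pi>\<^sub>E i\<in>{1..r}. ?S i)" "\<forall>i<r. ?prev P i \<subseteq> P (Suc i)"
      and H: "subgroup H G" "card H = p ^ b (Suc r)" "?prev P r \<subseteq> H"
      using that unfolding C_def ext_def by blast+
    have "P(Suc r := H) \<in> (\<Pi>\<^sub>E i\<in>{1..Suc r}. ?S i)"
      using P(1) H by (auto simp: PiE_iff extensional_def le_Suc_eq)
    moreover have "?prev (P(Suc r := H)) i \<subseteq> (P(Suc r := H)) (Suc i)" if "i < Suc r" for i
      using P(2)[rule_format, of i] H(3) that by (cases "i = r") (auto split: if_splits)
    ultimately show ?thesis unfolding C_def by blast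
  qed
  have truncate: "P(Suc r := undefined) \<in> C r \<and> P (Suc r) \<in> ext (P(Suc r := undefined))"
    if "P \<in> C (Suc r)" for P
  proof -
    have P: "P \<in> (\<Pi>\<^sub>E i\<in>{1..Suc r}. ?S i)" and sub: "\<And>i. i < Suc r \<Longrightarrow> ?prev P i \<subseteq> P (Suc i)"
      using that unfolding C_def by blast+
    have "P(Suc r := undefined) \<in> (\<Pi>\<^sub>E i\<in>{1..r}. ?S i)"
      using P by (auto simp: PiE_iff extensional_def le_Suc_eq)
    moreover have "?prev (P(Suc r := undefined)) i \<subseteq> (P(Suc r := undefined)) (Suc i)" if "i < r" for i
      using sub[of i] that by (auto split: if_splits)
    moreover have "P (Suc r) \<in> ext (P(Suc r := undefined))"
      using P sub[of r] unfolding ext_def by (auto simp: PiE_iff split: if_splits)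
    ultimately show ?thesis unfolding C_def by blast
  qed
  \<comment> \<open>Outside its index set an extensional tuple is \<open>undefined\<close>, so truncation must restore this value.\<close>
  have "bij_betw (\<lambda>(P, H). P(Suc r := H)) (Sigma (C r) ext) (C (Suc r))"
  proof (rule bij_betw_byWitness[where f' = "\<lambda>P. (P(Suc r := undefined), P (Suc r))"])
    show "\<forall>PH\<in>Sigma (C r) ext.
        (\<lambda>P. (P(Suc r := undefined), P (Suc r))) ((\<lambda>(P, H). P(Suc r := H)) PH) = PH"
      by (auto simp: C_def PiE_iff extensional_def fun_eq_iff)
    show "\<forall>P\<in>C (Suc r). (\<lambda>(P, H). P(Suc r := H)) (P(Suc r := undefined), P (Suc r)) = P"
      by auto
    show "(\<lambda>(P, H). P(Suc r := H)) ` Sigma (C r) ext \<subseteq> C (Suc r)"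
      using extend by auto
    show "(\<lambda>P. (P(Suc r := undefined), P (Suc r))) ` C (Suc r) \<subseteq> Sigma (C r) ext"
      using truncate by auto
  qed
  then have "card (C (Suc r)) = card (Sigma (C r) ext)"
    by (simp add: bij_betw_same_card)
  moreover have "[card (Sigma (C r) ext) = card (C r)] (mod p)"
  proof (rule card_Sigma_cong[OF finC])
    show "finite (ext P)" for P unfolding ext_def by (rule finite_subset[OF _ finS[of "Suc r"]]) auto
  qed (rule card_ext)
  moreover have "[card (C r) = 1] (mod p)"
    unfolding C_def
  proof (rule Suc.IH)
    show "mono_on {0..r} b" using Suc.prems(1) by (rule mono_on_subset) simp
    show "p ^ b r dvd order G" using le Suc.prems(2) by (meson le_imp_power_dvd dvd_trans)
  qed
  ultimately have "[card (C (Suc r)) = 1] (mod p)" using cong_trans by metis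
  then show ?case unfolding C_def .
qed

theorem theorem1:
  fixes G :: "('a, 'c) monoid_scheme" (structure)
    and N p r :: nat
    and b :: "nat \<Rightarrow> nat"
    and P0 :: "'a set"
  assumes "group G" and "finite (carrier G)" and "order G = N"
    and "prime p"
    and "r \<ge> 1"
    and "strict_mono_on {0..r} b"
    and "p ^ b r dvd N"
    and "subgroup P0 G" and "card P0 = p ^ b 0"
  shows "[card {P \<in> (\<Pi>\<^sub>E i\<in>{1..r}. {H. subgroup H G \<and> card H = p ^ b i}).
            P0 \<subseteq> P 1 \<and> (\<forall>i\<in>{1..<r}. P i \<subseteq> P (Suc i))} = 1] (mod p)"
proof -
  have chain: "(P0 \<subseteq> P 1 \<and> (\<forall>i\<in>{1..<r}. P i \<subseteq> P (Suc i)))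
      \<longleftrightarrow> (\<forall>i<r. (if i = 0 then P0 else P i) \<subseteq> P (Suc i))" for P :: "nat \<Rightarrow> 'a set"
    using \<open>r \<ge> 1\<close> by auto
  show ?thesis
    unfolding chain
  proof (rule group.card_prime_power_subgroup_chains_cong_1[where b = b and r = r, OF assms(1,2,4,8,9)])
    show "mono_on {0..r} b" using assms(6) by (rule strict_mono_on_imp_mono_on)
    show "p ^ b r dvd order G" using assms(3,7) by simp
  qed
qed

end
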